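(* Suppose that $(\bar A,\bar B)$ is stabilizable (Assumption 1) and that the pair $(\bar C,\bar A)$ is undetectable, the only undetectable eigenvalue of $\bar A$ for the pair $(\bar C,\bar A)$ is $0$, and its algebraic multiplicity and geometric multiplicity are equal (Assumption 2). Consider the optimal control problem of minimizing $\bar J=\frac12\int_0^\infty(\bar x^\top\bar Q\bar x+\|v\|^2)\,dt$ subject to $\dot{\bar x}=\bar A\bar x+\bar B v$, with $\bar Q=\bar C^\top\bar C$. Then the steady-state space $\operatorname{Ker}(\bar A_{cl})$, where $\bar A_{cl}=\bar A-\bar B\bar B^\top P$, satisfies $$\operatorname{Ker}(\bar A_{cl})=\operatorname{Ker}\left(\begin{bmatrix}\bar A\\ \bar C\end{bmatrix}\right).$$
   Context: Setting. Let $A\in\mathbb R^{n\times n}$, $B\in\mathbb R^{n\times m}$ and consider the multi-agent system $\dot x=Ax+Bu$ with $x(t)\in\mathbb R^n$, $u(t)\in\mathbb R^m$. An exogenous system with state $w\in\mathbb R^k$ and new control $v\in\mathbb R^p$ is attached: $\dot w=F_1x+F_2w+Gv$, $u=Hw+Kv$, with $F_1\in\mathbb R^{k\times n}$, $F_2\in\mathbb R^{k\times k}$, $G\in\mathbb R^{k\times p}$, $H\in\mathbb R^{m\times k}$, $K\in\mathbb R^{m\times p}$. Let $Q=C^\top C$ with $C\in\mathbb R^{q\times n}$. Put $$\bar x=\begin{bmatrix}x\\ w\end{bmatrix},\quad \bar A=\begin{bmatrix}A&BH\\ F_1&F_2\end{bmatrix},\quad \bar B=\begin{bmatrix}BK\\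 G\end{bmatrix},\quad \bar C=[\,C\ \ 0_{q\times k}\,],\quad \bar Q=\bar C^\top\bar C=\begin{bmatrix}Q&0\\ 0&0\end{bmatrix}.$$ $P\in\mathbb R^{(n+k)\times(n+k)}$ denotes the smallest real symmetric positive semi-definite solution of the algebraic Riccati equation $\bar A^\top P+P\bar A-P\bar B\bar B^\top P+\bar Q=0$ (smallest: $P_0-P$ is positive semi-definite for every other real symmetric positive semi-definite solution $P_0$); it exists when $(\bar A,\bar B)$ is stabilizable, and the optimal control is $v^*=-\bar B^\top P\bar x$. The closed-loop system is $\dot{\bar x}=\bar A_{cl}\bar x$ with $\bar A_{cl}=\bar A-\bar B\bar B^\top P$. An undetectable eigenvalue of $\bar A$ for $(\bar C,\bar A)$ is a $\lambda\in\mathbb C$ with $\operatorname{Re}\lambda\ge 0$ for which there is $\phi\ne0$ with $\bar A\phi=\lambda\phi$, $\bar C\phi=0$. Equality of the algebraic and geometric multiplicities of the undetectable eigenvalue $0$ means: there are no $\phi\neq 0$ and $\hat\phi$ with $\bar A\phi=0$, $\bar C\phi=0$, $\bar A\hat\phi=\phi$, $\bar C\hat\phi=0$. *)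

theory Defs
  imports "HOL-Analysis.Analysis"
begin

definition hstack :: "'a^'n^'r \<Rightarrow> 'a^'k^'r \<Rightarrow> 'a^('n + 'k)^'r" where
  "hstack M N = (\<chi> i j. case j of Inl a \<Rightarrow> M $ i $ a | Inr b \<Rightarrow> N $ i $ b)"

definition vstack :: "'a^'n^'r \<Rightarrow> 'a^'n^'s \<Rightarrow> 'a^'n^('r + 's)" where
  "vstack M N = (\<chi> i. case i of Inl a \<Rightarrow> M $ a | Inr b \<Rightarrow> N $ b)"

definition Ker :: "real^'n^'r \<Rightarrow> (real^'n) set" where
  "Ker M = {x. M *v x = 0}"

text \<open>Spectral notions refer to complex eigenvectors, so real matrices are complexified.\<close>

abbreviation cmat :: "real^'n^'r \<Rightarrow> complex^'n^'r" where
  "cmat M \<equiv> map_matrix complex_of_real M"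

definition eigenvalue :: "real^'n^'n \<Rightarrow> complex \<Rightarrow> bool" where
  "eigenvalue A l \<longleftrightarrow> (\<exists>\<phi>. \<phi> \<noteq> 0 \<and> cmat A *v \<phi> = l *s \<phi>)"

definition hurwitz :: "real^'n^'n \<Rightarrow> bool" where
  "hurwitz A \<longleftrightarrow> (\<forall>l. eigenvalue A l \<longrightarrow> Re l < 0)"

definition stabilizable :: "real^'n^'n \<Rightarrow> real^'m^'n \<Rightarrow> bool" where
  "stabilizable A B \<longleftrightarrow> (\<exists>F :: real^'n^'m. hurwitz (A + B ** F))"

definition detectable :: "real^'n^'q \<Rightarrow> real^'n^'n \<Rightarrow> bool" where
  "detectable C A \<longleftrightarrow> (\<exists>L :: real^'q^'n. hurwitz (A + L ** C))"

definition undetectable_eigenvalue :: "real^'n^'q \<Rightarrow> real^'n^'n \<Rightarrow> complex \<Rightarrow> bool" where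
  "undetectable_eigenvalue C A l \<longleftrightarrow>
     Re l \<ge> 0 \<and> (\<exists>\<phi>. \<phi> \<noteq> 0 \<and> cmat A *v \<phi> = l *s \<phi> \<and> cmat C *v \<phi> = 0)"

text \<open>
  Algebraic and geometric multiplicity of the undetectable eigenvalue 0 agree: A has no Jordan
  chain of length two at 0 inside the kernel of C. (This is not a condition on the whole
  generalized eigenspace of A at 0.)
\<close>

definition zero_undetectable_semisimple :: "real^'n^'q \<Rightarrow> real^'n^'n \<Rightarrow> bool" where
  "zero_undetectable_semisimple C A \<longleftrightarrow>
     \<not> (\<exists>\<phi> \<psi>. \<phi> \<noteq> 0 \<and> cmat A *v \<phi> = 0 \<and> cmat C *v \<phi> = 0 \<and>
              cmat A *v \<psi> = \<phi> \<and> cmat C *v \<psi> = 0)"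

definition psd :: "real^'n^'n \<Rightarrow> bool" where
  "psd P \<longleftrightarrow> transpose P = P \<and> (\<forall>x. 0 \<le> x \<bullet> (P *v x))"

text \<open>The control weight in the Riccati equation is the identity.\<close>

definition riccati_solution ::
  "real^'n^'n \<Rightarrow> real^'m^'n \<Rightarrow> real^'n^'n \<Rightarrow> real^'n^'n \<Rightarrow> bool" where
  "riccati_solution A B Q P \<longleftrightarrow>
     transpose A ** P + P ** A - P ** B ** transpose B ** P + Q = 0"

definition smallest_psd_riccati_solution ::
  "real^'n^'n \<Rightarrow> real^'m^'n \<Rightarrow> real^'n^'n \<Rightarrow> real^'n^'n \<Rightarrow> bool" where
  "smallest_psd_riccati_solution A B Q P \<longleftrightarrow>
     psd P \<and> riccati_solution A B Q P \<and>
     (\<forall>P0. psd P0 \<and> riccati_solution A B Q P0 \<longrightarrow> psd (P0 - P))"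

end

theory Submission
  imports Defs
begin

text \<open>
  The equality is read off from the Riccati equation. With \<open>P\<close> symmetric, evaluating the
  equation as a quadratic form at \<open>x\<close> gives the energy balance (\<open>riccati_energy_balance\<close>)
  \<open>2 (P x) \<bullet> (A x) = \<parallel>B\<^sup>T P x\<parallel>\<^sup>2 - \<parallel>C x\<parallel>\<^sup>2\<close>: along a trajectory of the uncontrolled system the
  value function \<open>x \<bullet> P x\<close> changes at this rate.

  At a closed-loop equilibrium the drift is cancelled by the control, \<open>A x = B B\<^sup>T P x\<close>, so the
  left-hand side equals \<open>2 \<parallel>B\<^sup>T P x\<parallel>\<^sup>2\<close>. Hence the running cost
  \<open>\<parallel>B\<^sup>T P x\<parallel>\<^sup>2 + \<parallel>C x\<parallel>\<^sup>2\<close> vanishes there; both terms vanish, and without control \<open>A x = 0\<close>.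
  Conversely, at an open-loop equilibrium invisible to the output the balance reduces to
  \<open>\<parallel>B\<^sup>T P x\<parallel>\<^sup>2 = 0\<close>, so the optimal control is switched off and the equilibrium persists in
  closed loop. Both directions are carried out in \<open>Ker_closed_loop\<close>.
\<close>

lemma Ker_vstack: "Ker (vstack M N) = Ker M \<inter> Ker N"
  for M :: "real^'n^'r" and N :: "real^'n^'s"
proof -
  have "vstack M N *v x = 0 \<longleftrightarrow> M *v x = 0 \<and> N *v x = 0" for x
  proof -
    have "(vstack M N *v x) $ Inl i = (M *v x) $ i" for i
      by (simp add: vstack_def matrix_vector_mult_def)
    moreover have "(vstack M N *v x) $ Inr i = (N *v x) $ i" for i
      by (simp add: vstack_def matrix_vector_mult_def)
    ultimately show ?thesis
      by (simp add: vec_eq_iff split_sum_all)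
  qed
  then show ?thesis
    by (auto simp: Ker_def)
qed

lemma inner_transpose_mult: "x \<bullet> (transpose M *v y) = (M *v x) \<bullet> y"
  for M :: "real^'n^'r"
  by (metis dot_lmul_matrix inner_commute transpose_matrix_vector)

text \<open>
  In the Riccati equation, read as a quadratic form at \<open>x\<close>, symmetry of \<open>P\<close> makes the two
  terms linear in \<open>P\<close> equal and turns the quadratic term into a square.
\<close>

lemma riccati_energy_balance:
  fixes A P :: "real^'n^'n" and B :: "real^'p^'n" and C :: "real^'n^'q"
  assumes ric: "riccati_solution A B (transpose C ** C) P"
    and sym: "transpose P = P"
  shows "2 * ((P *v x) \<bullet> (A *v x))
    = (norm (transpose B *v (P *v x)))\<^sup>2 - (norm (C *v x))\<^sup>2"
proof -
  let ?u = "transpose B *v (P *v x)"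
  have move_P: "x \<bullet> (P *v y) = (P *v x) \<bullet> y" for y
    using inner_transpose_mult[of x P y] sym by simp
  have "x \<bullet> ((transpose A ** P + P ** A - P ** B ** transpose B ** P
      + transpose C ** C) *v x) = 0"
    using ric by (simp add: riccati_solution_def)
  then have "x \<bullet> (transpose A *v (P *v x)) + x \<bullet> (P *v (A *v x))
      - x \<bullet> (P *v (B *v ?u)) + x \<bullet> (transpose C *v (C *v x)) = 0"
    by (simp add: matrix_vector_mult_add_rdistrib matrix_vector_mult_diff_rdistrib
        inner_add_right inner_diff_right flip: matrix_vector_mul_assoc)
  moreover have "x \<bullet> (transpose A *v (P *v x)) = (P *v x) \<bullet> (A *v x)"
    by (metis inner_transpose_mult inner_commute)
  moreover have "x \<bullet> (P *v (B *v ?u)) = (norm ?u)\<^sup>2"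
    by (metis move_P inner_commute inner_transpose_mult power2_norm_eq_inner)
  moreover have "x \<bullet> (transpose C *v (C *v x)) = (norm (C *v x))\<^sup>2"
    by (metis inner_transpose_mult power2_norm_eq_inner)
  ultimately show ?thesis
    by (simp add: move_P)
qed

lemma Ker_closed_loop:
  fixes A P :: "real^'n^'n" and B :: "real^'p^'n" and C :: "real^'n^'q"
  assumes ric: "riccati_solution A B (transpose C ** C) P"
    and sym: "transpose P = P"
  shows "Ker (A - B ** transpose B ** P) = Ker A \<inter> Ker C"
proof -
  define u where "u x = transpose B *v (P *v x)" for x
  have balance: "2 * ((P *v x) \<bullet> (A *v x)) = (norm (u x))\<^sup>2 - (norm (C *v x))\<^sup>2" for x
    using riccati_energy_balance[OF assms] by (simp add: u_def)
  have closed: "(A - B ** transpose B ** P) *v x = A *v x - B *v u x" for x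
    by (simp add: u_def matrix_vector_mult_diff_rdistrib flip: matrix_vector_mul_assoc)
  have "A *v x - B *v u x = 0 \<longleftrightarrow> A *v x = 0 \<and> C *v x = 0" for x
  proof
    assume eq: "A *v x - B *v u x = 0"
    have "(P *v x) \<bullet> (B *v u x) = (norm (u x))\<^sup>2"
      by (metis u_def inner_commute inner_transpose_mult power2_norm_eq_inner)
    with eq balance[of x] have "(norm (u x))\<^sup>2 + (norm (C *v x))\<^sup>2 = 0"
      by simp
    then have "u x = 0" "C *v x = 0"
      by (simp_all add: sum_power2_eq_zero_iff)
    with eq show "A *v x = 0 \<and> C *v x = 0"
      by simp
  next
    assume "A *v x = 0 \<and> C *v x = 0"
    with balance[of x] show "A *v x - B *v u x = 0"
      by simp
  qed
  then show ?thesis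
    by (auto simp: Ker_def closed)
qed


theorem proposition1:
  fixes A :: "real^'n^'n" and B :: "real^'m^'n" and C :: "real^'n^'q"
    and F1 :: "real^'n^'k" and F2 :: "real^'k^'k" and G :: "real^'p^'k"
    and H :: "real^'k^'m" and K :: "real^'p^'m"
    and Abar :: "real^('n + 'k)^('n + 'k)" and Bbar :: "real^'p^('n + 'k)"
    and Cbar :: "real^('n + 'k)^'q"
    and Qbar P Acl :: "real^('n + 'k)^('n + 'k)"
  assumes Abar: "Abar = vstack (hstack A (B ** H)) (hstack F1 F2)"
    and Bbar: "Bbar = vstack (B ** K) G"
    and Cbar: "Cbar = hstack C 0"
    and Qbar: "Qbar = transpose Cbar ** Cbar"
    and assumption1: "stabilizable Abar Bbar"
    and assumption2_undetectable: "\<not> detectable Cbar Abar"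
    and assumption2_only_zero: "{l. undetectable_eigenvalue Cbar Abar l} = {0}"
    and assumption2_multiplicity: "zero_undetectable_semisimple Cbar Abar"
    and P: "smallest_psd_riccati_solution Abar Bbar Qbar P"
    and Acl: "Acl = Abar - Bbar ** transpose Bbar ** P"
  shows "Ker Acl = Ker (vstack Abar Cbar)"
proof -
  have "riccati_solution Abar Bbar (transpose Cbar ** Cbar) P" and "transpose P = P"
    using P Qbar by (auto simp: smallest_psd_riccati_solution_def psd_def)
  then show ?thesis
    by (simp add: Acl Ker_closed_loop Ker_vstack)
qed

end
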